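(* Let $I\subseteq\mathbb{R}$ be an interval, let $G:I\to(0,1)$ be a continuous strictly increasing bijection, and let $X,X_1,X_2,\ldots$ be i.i.d. with law $P$, $P(I)=1$. Let $p_G=\mathbb{E}[G(X)]$ and $b_G=G^{-1}(p_G)$. Assume that $G$ is continuously differentiable on a neighbourhood of $b_G$ and that $G'(b_G)>0$. Let $\alpha\in(0,1)$, let $z_{1-\alpha/2}$ be the $(1-\alpha/2)$-quantile of the standard normal law, and, with $U_i=G(X_i)$ and $n\ge2$, set $$\widehat p_G=\frac1n\sum_{i=1}^nU_i,\qquad \widehat v_G=\frac1{n-1}\sum_{i=1}^n(U_i-\widehat p_G)^2,$$ $$I_{p,n}(\alpha)=\left[\widehat p_G-z_{1-\alpha/2}\sqrt{\frac{\widehat v_G}{n}},\ \widehat p_G+z_{1-\alpha/2}\sqrt{\frac{\widehat v_G}{n}}\right]\cap[0,1].$$ Then, as $n\to\infty$, $\mathbb{P}(p_G\in I_{p,n}(\alpha))\to1-\alpha$. Moreover, with the extended inverse convention $G^{-1}(0)=\inf I$, $G^{-1}(1)=\sup I$, the set $I_{b,n}(\alpha)=G^{-1}(I_{p,n}(\alpha))$ satisfies $\mathbb{P}(b_G\in I_{b,n}(\alpha))\to1-\alpha$.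
   Context: $G$ is called a probability coordinate chart, $p_G$ the coordinate mean, and $b_G$ the probability barycenter. $I_{b,n}(\alpha)$ is the image of $I_{p,n}(\alpha)$ under the extended inverse; the values $\inf I$ and $\sup I$ may be $-\infty$ and $+\infty$.
   Formalization: The formal theorem also assumes Var(G(X)) > 0, i.e. that P is not a point mass; for a point mass the estimated variance is 0, the interval is {p_G}, and the coverage probability is 1 for every n rather than tending to 1−α. *)

theory Defs
  imports "HOL-Probability.Probability"
begin

definition prob_chart :: "real set \<Rightarrow> (real \<Rightarrow> real) \<Rightarrow> bool" where
  "prob_chart I G \<longleftrightarrow>
     is_interval I \<and> continuous_on I G \<and> strict_mono_on I G \<and> bij_betw G I {0<..<1}"

(* HOL functions are total, so a chart G : I -> (0,1) has arbitrary, possibly non-measurable,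
   values outside I. Composing with a variable X that is only almost surely I-valued could
   then fail to be measurable, and its Bochner integral would be the default 0. The coordinate
   variable G(X) is therefore taken to be 0 where X leaves I, which is a null event. *)
definition coord :: "real set \<Rightarrow> (real \<Rightarrow> real) \<Rightarrow> ('w \<Rightarrow> real) \<Rightarrow> 'w \<Rightarrow> real" where
  "coord I G X \<omega> = (if X \<omega> \<in> I then G (X \<omega>) else 0)"

definition coord_mean ::
    "'w measure \<Rightarrow> real set \<Rightarrow> (real \<Rightarrow> real) \<Rightarrow> ('w \<Rightarrow> real) \<Rightarrow> real" where
  "coord_mean M I G X = prob_space.expectation M (coord I G X)"

definition prob_barycenter ::
    "'w measure \<Rightarrow> real set \<Rightarrow> (real \<Rightarrow> real) \<Rightarrow> ('w \<Rightarrow> real) \<Rightarrow> real" where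
  "prob_barycenter M I G X = the_inv_into I G (coord_mean M I G X)"

definition quantile :: "real measure \<Rightarrow> real \<Rightarrow> real" where
  "quantile \<mu> q = Inf {x. q \<le> cdf \<mu> x}"

(* The sample is X 1, X 2, ...; the entry X 0 is not used. *)
definition coord_sample_mean ::
    "real set \<Rightarrow> (real \<Rightarrow> real) \<Rightarrow> (nat \<Rightarrow> 'w \<Rightarrow> real) \<Rightarrow> nat \<Rightarrow> 'w \<Rightarrow> real" where
  "coord_sample_mean I G X n \<omega> = (1 / real n) * (\<Sum>i=1..n. coord I G (X i) \<omega>)"

definition coord_sample_var ::
    "real set \<Rightarrow> (real \<Rightarrow> real) \<Rightarrow> (nat \<Rightarrow> 'w \<Rightarrow> real) \<Rightarrow> nat \<Rightarrow> 'w \<Rightarrow> real" where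
  "coord_sample_var I G X n \<omega> =
     (1 / (real n - 1)) * (\<Sum>i=1..n. (coord I G (X i) \<omega> - coord_sample_mean I G X n \<omega>)\<^sup>2)"

definition mean_interval ::
    "real set \<Rightarrow> (real \<Rightarrow> real) \<Rightarrow> (nat \<Rightarrow> 'w \<Rightarrow> real) \<Rightarrow> real \<Rightarrow> nat \<Rightarrow> 'w \<Rightarrow> real set" where
  "mean_interval I G X \<alpha> n \<omega> =
     (let p = coord_sample_mean I G X n \<omega>;
          h = quantile std_normal_distribution (1 - \<alpha> / 2)
                * sqrt (coord_sample_var I G X n \<omega> / real n)
      in {p - h .. p + h} \<inter> {0..1})"

(* Infimum and supremum of I are taken in the extended reals, so they may be infinite. *)
definition chart_inv_ext :: "real set \<Rightarrow> (real \<Rightarrow> real) \<Rightarrow> real \<Rightarrow> ereal" where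
  "chart_inv_ext I G u =
     (if u = 0 then Inf (ereal ` I)
      else if u = 1 then Sup (ereal ` I)
      else ereal (the_inv_into I G u))"

definition barycenter_interval ::
    "real set \<Rightarrow> (real \<Rightarrow> real) \<Rightarrow> (nat \<Rightarrow> 'w \<Rightarrow> real) \<Rightarrow> real \<Rightarrow> nat \<Rightarrow> 'w \<Rightarrow> ereal set" where
  "barycenter_interval I G X \<alpha> n \<omega> = chart_inv_ext I G ` mean_interval I G X \<alpha> n \<omega>"

end

theory Submission
  imports Defs "HOL-Probability.Hoeffding" "HOL-Real_Asymp.Real_Asymp"
begin

text \<open>
  Let S be the standardised sum of the coordinates, s their variance and Q the average of the
  squared deviations from the true mean. Since the sample variance differs from Q only by a
  multiple of the squared deviation of the sample mean, p lies in the interval if and only if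
  S^2 is at most z^2 n / ((n - 1 + z^2) s) * Q. The central limit theorem gives the limit law of
  the left-hand side; by Hoeffding's inequality Q tends to s in probability, hence the right-hand
  side tends to z^2, and a Slutsky argument concludes. The second limit concerns the same events:
  the chart domain contains neither of its endpoints, so the extended inverse takes the value b
  only at p.
\<close>

text \<open>Events chosen for the indices in \<open>J\<close> are carried over to \<open>h\<close>
  J\<open>by the inverse of\<close>h\<open>; injectivity turns the product over\<close>h
  \<open>J\<close> back into one over \<open>J\<close>. This serves to renumber a sample that starts
  at 1 so that it starts at 0.\<close>

lemma (in prob_space) indep_vars_reindex:
  assumes "inj_on h I" "indep_vars M' X (h ` I)"
  shows "indep_vars (\<lambda>i. M' (h i)) (\<lambda>i. X (h i)) I"
proof -
  let ?F = "\<lambda>i. {X i -` A \<inter> space M | A. A \<in> sets (M' i)}"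
  have "indep_sets (\<lambda>i. ?F (h i)) I"
  proof (rule indep_setsI)
    fix A J assume J: "J \<noteq> {}" "J \<subseteq> I" "finite J" and A: "\<forall>j\<in>J. A j \<in> ?F (h j)"
    have inj: "inj_on h J"
      using assms(1) J(2) inj_on_subset by blast
    let ?g = "the_inv_into J h"
    have g: "?g (h j) = j" if "j \<in> J" for j
      using the_inv_into_f_f[OF inj that] .
    have "prob (\<Inter>j\<in>h ` J. A (?g j)) = (\<Prod>j\<in>h ` J. prob (A (?g j)))"
      by (rule indep_setsD[of ?F "h ` I"])
        (use assms(2) J A in \<open>auto simp: indep_vars_def2 g\<close>)
    then show "prob (\<Inter>j\<in>J. A j) = (\<Prod>j\<in>J. prob (A j))"
      by (simp add: prod.reindex[OF inj] g cong: INF_cong)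
  qed (use assms(2) in \<open>auto simp: indep_vars_def2\<close>)
  then show ?thesis
    using assms(2) by (auto simp: indep_vars_def2)
qed

section \<open>Distribution function and quantiles of the standard normal law\<close>

lemma measure_std_normal_singleton: "measure std_normal_distribution {x} = 0"
proof -
  have "emeasure std_normal_distribution {x} = 0"
    by (subst emeasure_density) (auto simp: nn_integral_0_iff_AE intro!: AE_I[where N="{x}"])
  then show ?thesis by (simp add: measure_def)
qed

lemma isCont_cdf_std_normal: "isCont (cdf std_normal_distribution) x"
  using real_dist_normal_dist
  by (simp add: finite_borel_measure.isCont_cdf measure_std_normal_singleton
      real_distribution.finite_borel_measure_M)

text \<open>The affine map with slope -1 and shift 0 preserves the law, so the lower tail at
  \<open>- x\<close> is the upper tail at \<open>x\<close>. Points being null, it does not matter on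
  which side \<open>x\<close> itself is counted.\<close>

lemma cdf_std_normal_minus:
  "cdf std_normal_distribution (- x) = 1 - cdf std_normal_distribution x"
proof -
  interpret N: real_distribution std_normal_distribution by (rule real_dist_normal_dist)
  have "distributed std_normal_distribution lborel (\<lambda>x. x) std_normal_density"
    by (simp add: distributed_def distr_id2)
  from N.normal_density_affine[OF this, of "-1" 0]
  have "distr std_normal_distribution lborel uminus = std_normal_distribution"
    by (simp add: distributed_def)
  then have "measure std_normal_distribution {..- x} =
      measure (distr std_normal_distribution lborel uminus) {..- x}"
    by simp
  also have "\<dots> = measure std_normal_distribution (UNIV - {..<x})"
    by (subst measure_distr) (auto intro!: arg_cong[where f="measure std_normal_distribution"])
  also have "\<dots> = 1 - measure std_normal_distribution {..<x}"
    using N.prob_compl[of "{..<x}"] by simp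
  also have "measure std_normal_distribution {..<x} = measure std_normal_distribution {..x}"
  proof -
    have "{..x} = {..<x} \<union> {x}" by auto
    then show ?thesis
      using N.finite_measure_Union[of "{..<x}" "{x}"] by (simp add: measure_std_normal_singleton)
  qed
  finally show ?thesis by (simp add: cdf_def2)
qed

text \<open>Continuity makes the superlevel set \<open>?A\<close> closed, so its infimum belongs to
  it, which gives one inequality. The intermediate value theorem supplies a point of
  \<open>?A\<close> where the value is exactly \<open>q\<close>; monotonicity then gives the
  other.\<close>

lemma cdf_std_normal_quantile:
  assumes "0 < q" "q < 1"
  shows "cdf std_normal_distribution (quantile std_normal_distribution q) = q"
proof -
  interpret N: real_distribution std_normal_distribution by (rule real_dist_normal_dist)
  let ?F = "cdf std_normal_distribution"
  let ?A = "{x. q \<le> ?F x}"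
  have cont: "continuous_on UNIV ?F"
    by (simp add: continuous_at_imp_continuous_on isCont_cdf_std_normal)
  obtain a where a: "?F a < q"
    using order_tendstoD(2)[OF N.cdf_lim_at_bot assms(1)]
    by (auto simp: eventually_at_bot_linorder)
  obtain b where b: "q < ?F b"
    using order_tendstoD(1)[OF N.cdf_lim_at_top_prob assms(2)]
    by (auto simp: eventually_at_top_linorder)
  have "a \<le> b"
    using a b N.cdf_nondecreasing[of b a] by (cases "a \<le> b") auto
  then obtain x where x: "?F x = q"
    using IVT'[of ?F a q b] a b continuous_on_subset[OF cont] by force
  have bdd: "bdd_below ?A"
  proof (rule bdd_belowI)
    fix y assume "y \<in> ?A"
    then have "\<not> y \<le> a"
      using N.cdf_nondecreasing[of y a] a by auto
    then show "a \<le> y" by simp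
  qed
  have "closed ?A"
    using continuous_on_closed_Collect_le[OF continuous_on_const cont] by simp
  then have "Inf ?A \<in> ?A"
    using closed_contains_Inf[of ?A] bdd x by auto
  moreover have "?F (Inf ?A) \<le> q"
    using N.cdf_nondecreasing[OF cInf_lower[OF _ bdd, of x]] x by simp
  ultimately show ?thesis by (simp add: quantile_def)
qed

section \<open>Convergence in probability and in law\<close>

definition (in prob_space) tendsto_in_prob :: "(nat \<Rightarrow> 'a \<Rightarrow> real) \<Rightarrow> real \<Rightarrow> bool" where
  "tendsto_in_prob R c \<longleftrightarrow>
     (\<forall>\<epsilon>>0. (\<lambda>n. prob {\<omega> \<in> space M. \<epsilon> \<le> \<bar>R n \<omega> - c\<bar>}) \<longlonglongrightarrow> 0)"

text \<open>The error splits as r (Q - q) + (r - l) q. The second term is deterministic and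
  eventually below \<epsilon>/2, so a large error forces Q away from q.\<close>

lemma (in prob_space) tendsto_in_prob_mult_seq:
  assumes [measurable]: "\<And>n. random_variable borel (Q n)"
    and Q: "tendsto_in_prob Q q" and r: "r \<longlonglongrightarrow> l"
  shows "tendsto_in_prob (\<lambda>n \<omega>. r n * Q n \<omega>) (l * q)"
  unfolding tendsto_in_prob_def
proof (intro allI impI)
  fix \<epsilon> :: real assume \<epsilon>: "\<epsilon> > 0"
  \<comment> \<open>An eventual strict bound for \<open>\<bar>r n\<bar>\<close>, positive even when
    \<open>l = 0\<close>, so that division by \<open>2 * B\<close> is safe.\<close>
  define B where "B = \<bar>l\<bar> + 1"
  have B: "B > 0" by (simp add: B_def)
  have "(\<lambda>n. \<bar>r n\<bar>) \<longlonglongrightarrow> \<bar>l\<bar>" "(\<lambda>n. \<bar>r n - l\<bar> * \<bar>q\<bar>) \<longlonglongrightarrow> \<bar>l - l\<bar> * \<bar>q\<bar>"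
    by (intro tendsto_intros r)+
  then have ev: "\<forall>\<^sub>F n in sequentially. \<bar>r n\<bar> < B"
      "\<forall>\<^sub>F n in sequentially. \<bar>r n - l\<bar> * \<bar>q\<bar> < \<epsilon> / 2"
    using \<epsilon> order_tendstoD(2)[of _ 0 _ "\<epsilon> / 2"] by (auto elim!: order_tendstoD simp: B_def simp del: less_divide_eq_numeral1)
  show "(\<lambda>n. prob {\<omega> \<in> space M. \<epsilon> \<le> \<bar>r n * Q n \<omega> - l * q\<bar>}) \<longlonglongrightarrow> 0"
  proof (rule tendsto_sandwich[OF _ _ tendsto_const])
    show "(\<lambda>n. prob {\<omega> \<in> space M. \<epsilon> / (2 * B) \<le> \<bar>Q n \<omega> - q\<bar>}) \<longlonglongrightarrow> 0"
      using Q \<epsilon> B by (simp add: tendsto_in_prob_def)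
    show "\<forall>\<^sub>F n in sequentially. prob {\<omega> \<in> space M. \<epsilon> \<le> \<bar>r n * Q n \<omega> - l * q\<bar>}
        \<le> prob {\<omega> \<in> space M. \<epsilon> / (2 * B) \<le> \<bar>Q n \<omega> - q\<bar>}"
      using ev
    proof eventually_elim
      case (elim n)
      show ?case
      proof (rule finite_measure_mono)
        have "\<epsilon> / (2 * B) \<le> \<bar>Q n \<omega> - q\<bar>" if "\<epsilon> \<le> \<bar>r n * Q n \<omega> - l * q\<bar>" for \<omega>
        proof -
          have "\<bar>r n * Q n \<omega> - l * q\<bar> = \<bar>r n * (Q n \<omega> - q) + (r n - l) * q\<bar>"
            by (simp add: algebra_simps)
          also have "\<dots> \<le> \<bar>r n\<bar> * \<bar>Q n \<omega> - q\<bar> + \<bar>r n - l\<bar> * \<bar>q\<bar>"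
            by (metis abs_mult abs_triangle_ineq)
          also have "\<bar>r n\<bar> * \<bar>Q n \<omega> - q\<bar> \<le> B * \<bar>Q n \<omega> - q\<bar>"
            using elim(1) by (intro mult_right_mono) auto
          finally have "\<epsilon> / 2 \<le> B * \<bar>Q n \<omega> - q\<bar>"
            using that elim(2) by linarith
          then show ?thesis using B by (simp add: field_simps)
        qed
        then show "{\<omega> \<in> space M. \<epsilon> \<le> \<bar>r n * Q n \<omega> - l * q\<bar>}
            \<subseteq> {\<omega> \<in> space M. \<epsilon> / (2 * B) \<le> \<bar>Q n \<omega> - q\<bar>}"
          by auto
      qed simp
    qed
  qed simp
qed

text \<open>A form of Slutsky's theorem: outside the event that \<open>R n\<close> is at least
  \<delta> away from \<open>c\<close>, the random threshold lies between the constants c - \<delta>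
  and c + \<delta>. Convergence to \<open>F\<close> is required only near \<open>c\<close>, because
  the \<open>F\<close> of the application is the right limit for positive arguments only.\<close>

lemma (in prob_space) prob_le_tendsto_in_prob:
  fixes F :: "real \<Rightarrow> real"
  assumes [measurable]: "\<And>n. random_variable borel (Y n)" "\<And>n. random_variable borel (R n)"
    and Y: "\<forall>\<^sub>F x in nhds c. (\<lambda>n. prob {\<omega> \<in> space M. Y n \<omega> \<le> x}) \<longlonglongrightarrow> F x"
    and F: "isCont F c" and R: "tendsto_in_prob R c"
  shows "(\<lambda>n. prob {\<omega> \<in> space M. Y n \<omega> \<le> R n \<omega>}) \<longlonglongrightarrow> F c"
proof (rule LIMSEQ_I)
  fix \<epsilon> :: real assume \<epsilon>: "\<epsilon> > 0"
  have "\<forall>\<^sub>F x in nhds c. dist (F x) (F c) < \<epsilon> / 3"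
    using tendstoD[of F "F c" "nhds c" "\<epsilon> / 3"] F \<epsilon> by (simp add: continuous_at tendsto_at_iff_tendsto_nhds)
  with Y have "\<forall>\<^sub>F x in nhds c. (\<lambda>n. prob {\<omega> \<in> space M. Y n \<omega> \<le> x}) \<longlonglongrightarrow> F x \<and> dist (F x) (F c) < \<epsilon> / 3"
    by eventually_elim simp
  then obtain d where d: "d > 0"
    and *: "\<And>x. dist x c < d \<Longrightarrow>
      (\<lambda>n. prob {\<omega> \<in> space M. Y n \<omega> \<le> x}) \<longlonglongrightarrow> F x \<and> dist (F x) (F c) < \<epsilon> / 3"
    unfolding eventually_nhds_metric by blast
  define \<delta> where "\<delta> = d / 2"
  have \<delta>: "\<delta> > 0" "dist (c + \<delta>) c < d" "dist (c - \<delta>) c < d"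
    using d by (auto simp: \<delta>_def dist_real_def)
  let ?P = "\<lambda>n x. prob {\<omega> \<in> space M. Y n \<omega> \<le> x}"
  let ?D = "\<lambda>n. prob {\<omega> \<in> space M. \<delta> \<le> \<bar>R n \<omega> - c\<bar>}"
  let ?E = "\<lambda>n. prob {\<omega> \<in> space M. Y n \<omega> \<le> R n \<omega>}"
  have up: "?E n \<le> ?P n (c + \<delta>) + ?D n" for n
  proof -
    have "?E n \<le> prob ({\<omega> \<in> space M. Y n \<omega> \<le> c + \<delta>} \<union> {\<omega> \<in> space M. \<delta> \<le> \<bar>R n \<omega> - c\<bar>})"
      by (rule finite_measure_mono) auto
    also have "\<dots> \<le> ?P n (c + \<delta>) + ?D n"
      by (rule measure_Un_le) auto
    finally show ?thesis .
  qed
  have lo: "?P n (c - \<delta>) \<le> ?E n + ?D n" for n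
  proof -
    have "?P n (c - \<delta>) \<le> prob ({\<omega> \<in> space M. Y n \<omega> \<le> R n \<omega>} \<union> {\<omega> \<in> space M. \<delta> \<le> \<bar>R n \<omega> - c\<bar>})"
      by (rule finite_measure_mono) auto
    also have "\<dots> \<le> ?E n + ?D n"
      by (rule measure_Un_le) auto
    finally show ?thesis .
  qed
  have "?D \<longlonglongrightarrow> 0"
    using R \<delta>(1) by (simp add: tendsto_in_prob_def)
  note lims = this *[OF \<delta>(2), THEN conjunct1] *[OF \<delta>(3), THEN conjunct1]
  \<comment> \<open>The error has three parts, each below \<epsilon>/3: the probability that
    \<open>R n\<close> strays, the convergence at c + \<delta> or c - \<delta>, and the variation of
    \<open>F\<close> between that point and \<open>c\<close>.\<close>
  have "\<epsilon> / 3 > 0" using \<epsilon> by simp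
  note lims[THEN tendstoD, OF this]
  then have "\<forall>\<^sub>F n in sequentially. norm (?E n - F c) < \<epsilon>"
  proof eventually_elim
    case (elim n)
    then show ?case
      using up[of n] lo[of n] *[OF \<delta>(2)] *[OF \<delta>(3)]
      unfolding dist_real_def real_norm_def by linarith
  qed
  then show "\<exists>N. \<forall>n\<ge>N. norm (?E n - F c) < \<epsilon>"
    by (simp add: eventually_sequentially)
qed

text \<open>Hoeffding's inequality bounds the deviation probability by a quantity that decays
  exponentially in the sample size.\<close>

lemma (in prob_space) weak_law_iid_bounded:
  assumes indep: "indep_vars (\<lambda>_. borel) X (UNIV :: nat set)"
    and distr: "\<And>i. distr M borel (X i) = distr M borel Y"
    and [measurable]: "random_variable borel Y"
    and Y: "AE x in M. Y x \<in> {a..b}" and ab: "a < b"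
  shows "tendsto_in_prob (\<lambda>n \<omega>. (\<Sum>i<n. X i \<omega>) / real n) (expectation Y)"
  unfolding tendsto_in_prob_def
proof (intro allI impI)
  fix \<epsilon> :: real assume \<epsilon>: "\<epsilon> > 0"
  \<comment> \<open>The exponent per observation in Hoeffding's inequality for averages of variables
    in [a, b].\<close>
  define k where "k = 2 * \<epsilon>\<^sup>2 / (b - a)\<^sup>2"
  have k: "k > 0" using \<epsilon> ab by (simp add: k_def)
  have bound: "prob {\<omega> \<in> space M. \<epsilon> \<le> \<bar>(\<Sum>i<n. X i \<omega>) / real n - expectation Y\<bar>} \<le> 2 * exp (- k * real n)"
    if "n > 0" for n
  proof -
    interpret H: Hoeffding_ineq_iid M "{..<n}" X Y a b "expectation Y"
      by unfold_locales (use indep_vars_subset[OF indep] distr Y in auto)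
    show ?thesis
      using H.Hoeffding_ineq_abs_ge'[of \<epsilon>] \<epsilon> ab that by (simp add: k_def mult_ac lessThan_empty_iff)
  qed
  have "(\<lambda>n. 2 * exp (- k * real n)) \<longlonglongrightarrow> 0"
    using k by real_asymp
  then show "(\<lambda>n. prob {\<omega> \<in> space M. \<epsilon> \<le> \<bar>(\<Sum>i<n. X i \<omega>) / real n - expectation Y\<bar>}) \<longlonglongrightarrow> 0"
    by (rule tendsto_sandwich[OF _ _ tendsto_const, rotated -1])
      (use bound in \<open>auto intro!: eventually_sequentiallyI[of 1]\<close>)
qed

text \<open>The event says that \<open>S n\<close> lies in the interval from \<open>- sqrt x\<close>
  to \<open>sqrt x\<close>. Its frontier consists of two null points, so weak convergence passes to
  its measure, and the symmetry of the normal law evaluates the limit.\<close>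

lemma weak_conv_std_normal_square_le:
  assumes prob_space: "prob_space M" and [measurable]: "\<And>n. S n \<in> borel_measurable M"
    and conv: "weak_conv_m (\<lambda>n. distr M borel (S n)) std_normal_distribution"
    and x: "x > 0"
  shows "(\<lambda>n. measure M {\<omega> \<in> space M. (S n \<omega>)\<^sup>2 \<le> x})
     \<longlonglongrightarrow> 2 * cdf std_normal_distribution (sqrt x) - 1"
proof -
  interpret prob_space M by fact
  interpret N: real_distribution std_normal_distribution by (rule real_dist_normal_dist)
  let ?N = "std_normal_distribution" and ?A = "{- sqrt x..sqrt x}"
  have dist: "real_distribution (distr M borel (S n))" for n
    by simp
  have "frontier ?A = {- sqrt x} \<union> {sqrt x}"
    using x by (auto simp: frontier_def)
  then have "?N (frontier ?A) = 0"
    using measure_Un_le[of "{- sqrt x}" ?N "{sqrt x}"]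
    by (simp add: N.emeasure_eq_measure measure_std_normal_singleton measure_le_0_iff del: Un_insert_left)
  then have "(\<lambda>n. measure (distr M borel (S n)) ?A) \<longlonglongrightarrow> measure ?N ?A"
    by (intro weak_conv_imp_continuity_set_conv[OF dist real_dist_normal_dist conv]) auto
  moreover have "measure (distr M borel (S n)) ?A = prob {\<omega> \<in> space M. (S n \<omega>)\<^sup>2 \<le> x}" for n
  proof -
    have sq: "y\<^sup>2 \<le> x \<longleftrightarrow> \<bar>y\<bar> \<le> sqrt x" for y
      using real_sqrt_le_iff[of "y\<^sup>2" x] by simp
    have "S n -` ?A \<inter> space M = {\<omega> \<in> space M. (S n \<omega>)\<^sup>2 \<le> x}"
      unfolding sq abs_le_iff by auto
    then show ?thesis by (simp add: measure_distr)
  qed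
  moreover have "measure ?N ?A = 2 * cdf ?N (sqrt x) - 1"
  proof -
    have "?A = {- sqrt x} \<union> {- sqrt x<..sqrt x}"
      using x by auto
    then have "measure ?N ?A = measure ?N {- sqrt x<..sqrt x}"
      using N.finite_measure_Union[of "{- sqrt x}" "{- sqrt x<..sqrt x}"]
      by (simp add: measure_std_normal_singleton)
    also have "\<dots> = cdf ?N (sqrt x) - cdf ?N (- sqrt x)"
      using N.cdf_diff_eq[of "- sqrt x" "sqrt x"] x by simp
    finally show ?thesis by (simp add: cdf_std_normal_minus)
  qed
  ultimately show ?thesis by simp
qed

section \<open>Coverage of the studentized mean of bounded variables\<close>

lemma sum_square_diff_mean:
  fixes x :: "nat \<Rightarrow> real"
  assumes n: "n > 0"
  shows "(\<Sum>i<n. (x i - (\<Sum>i<n. x i) / real n)\<^sup>2) =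
    (\<Sum>i<n. (x i - \<mu>)\<^sup>2) - real n * ((\<Sum>i<n. x i) / real n - \<mu>)\<^sup>2"
proof -
  let ?m = "(\<Sum>i<n. x i) / real n"
  have sum: "(\<Sum>i<n. x i) = real n * ?m"
    using n by simp
  \<comment> \<open>Written this way, each summand differs from the square about \<mu> by a term
    affine in \<open>x i\<close>, whose sum is known from the mean.\<close>
  have "(\<Sum>i<n. (x i - ?m)\<^sup>2) = (\<Sum>i<n. (x i - \<mu>)\<^sup>2 - 2 * (?m - \<mu>) * x i + (?m\<^sup>2 - \<mu>\<^sup>2))"
    by (intro sum.cong) (auto simp: power2_eq_square algebra_simps)
  also have "\<dots> = (\<Sum>i<n. (x i - \<mu>)\<^sup>2) - 2 * (?m - \<mu>) * (real n * ?m) + real n * (?m\<^sup>2 - \<mu>\<^sup>2)"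
    by (simp only: sum.distrib sum_subtractf sum_distrib_left[symmetric] sum[symmetric])
      (simp add: right_diff_distrib)
  also have "\<dots> = (\<Sum>i<n. (x i - \<mu>)\<^sup>2) - real n * (?m - \<mu>)\<^sup>2"
    by (simp only: power2_eq_square) algebra
  finally show ?thesis .
qed

text \<open>Squaring, and expressing the sample variance through squares about \<mu>, makes the
  squared deviation of the mean appear on both sides; collecting it on the left produces the factor
  n - 1 + z^2. The equivalence is exact, and the right side involves only an average of i.i.d.
  terms.\<close>

lemma studentized_deviation_iff:
  fixes x :: "nat \<Rightarrow> real"
  assumes n: "n \<ge> 2" and z: "z > 0" and s: "s > 0"
  defines "m \<equiv> (\<Sum>i<n. x i) / real n"
  shows "\<bar>m - \<mu>\<bar> \<le> z * sqrt ((\<Sum>i<n. (x i - m)\<^sup>2) / (real n - 1) / real n) \<longleftrightarrow>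
    ((\<Sum>i<n. x i - \<mu>) / sqrt (real n * s))\<^sup>2 \<le>
      z\<^sup>2 * real n / ((real n - 1 + z\<^sup>2) * s) * ((\<Sum>i<n. (x i - \<mu>)\<^sup>2) / real n)"
proof -
  define q where "q = (\<Sum>i<n. (x i - \<mu>)\<^sup>2)"
  define d where "d = m - \<mu>"
  define N where "N = real n"
  have N: "N \<ge> 2" using n by (simp add: N_def)
  have ss: "(\<Sum>i<n. (x i - m)\<^sup>2) = q - N * d\<^sup>2"
    using n unfolding m_def q_def d_def N_def by (intro sum_square_diff_mean) simp
  have sum: "(\<Sum>i<n. x i - \<mu>) = N * d"
    using n by (simp add: sum_subtractf N_def d_def m_def field_simps)
  \<comment> \<open>Needed for the squared root below to return its argument.\<close>
  have nonneg: "q - N * d\<^sup>2 \<ge> 0"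
    unfolding ss[symmetric] by (intro sum_nonneg) simp
  have pos: "N * (N - 1) > 0" "N - 1 + z\<^sup>2 > 0"
    using N by (auto intro: add_pos_nonneg)
  have "\<bar>d\<bar> \<le> z * sqrt ((q - N * d\<^sup>2) / (N - 1) / N) \<longleftrightarrow>
      \<bar>d\<bar>\<^sup>2 \<le> (z * sqrt ((q - N * d\<^sup>2) / (N - 1) / N))\<^sup>2"
    using N z nonneg abs_le_square_iff[of d "z * sqrt ((q - N * d\<^sup>2) / (N - 1) / N)"] by simp
  also have "(z * sqrt ((q - N * d\<^sup>2) / (N - 1) / N))\<^sup>2 = z\<^sup>2 * (q - N * d\<^sup>2) / (N * (N - 1))"
    using N nonneg by (simp add: power_mult_distrib mult_ac)
  \<comment> \<open>After multiplication by N (N - 1), the term with -z^2 N d^2 moves to the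
    left.\<close>
  also have "\<bar>d\<bar>\<^sup>2 \<le> \<dots> \<longleftrightarrow> N * d\<^sup>2 * (N - 1 + z\<^sup>2) \<le> z\<^sup>2 * q"
    using pos by (simp add: pos_le_divide_eq algebra_simps)
  also have "\<dots> \<longleftrightarrow> N * d\<^sup>2 / s \<le> z\<^sup>2 * q / ((N - 1 + z\<^sup>2) * s)"
    using pos(2) s by (simp add: pos_le_divide_eq[OF pos(2)] divide_le_cancel flip: divide_divide_eq_left)
  also have "N * d\<^sup>2 / s = (N * d / sqrt (N * s))\<^sup>2"
    using N s by (simp add: power_divide power_mult_distrib power2_eq_square[of N])
  also have "z\<^sup>2 * q / ((N - 1 + z\<^sup>2) * s) = z\<^sup>2 * N / ((N - 1 + z\<^sup>2) * s) * (q / N)"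
    using N by simp
  finally show ?thesis
    unfolding ss sum by (simp only: d_def N_def q_def)
qed

text \<open>With the random threshold on the right of \<open>studentized_deviation_iff\<close>
  tending to z^2 in probability, the squared standardised sum is compared with it in the limit.
  Boundedness provides both the second moments and the law of large numbers for the squares.\<close>

lemma (in prob_space) studentized_mean_coverage:
  fixes U :: "nat \<Rightarrow> 'a \<Rightarrow> real" and Y :: "'a \<Rightarrow> real"
  assumes indep: "indep_vars (\<lambda>_. borel) U UNIV"
    and distr: "\<And>i. distr M borel (U i) = distr M borel Y"
    and Y[measurable]: "random_variable borel Y"
    and bounded: "AE x in M. Y x \<in> {a..b}"
    and var: "variance Y > 0" and z: "z > 0"
  defines "m \<equiv> \<lambda>n \<omega>. (\<Sum>i<n. U i \<omega>) / real n"
  defines "v \<equiv> \<lambda>n \<omega>. (\<Sum>i<n. (U i \<omega> - m n \<omega>)\<^sup>2) / (real n - 1)"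
  shows "(\<lambda>n. prob {\<omega> \<in> space M. \<bar>m n \<omega> - expectation Y\<bar> \<le> z * sqrt (v n \<omega> / real n)})
    \<longlonglongrightarrow> 2 * cdf std_normal_distribution z - 1"
proof -
  define \<mu> where "\<mu> = expectation Y"
  define s where "s = variance Y"
  have U[measurable]: "random_variable borel (U i)" for i
    using indep by (simp add: indep_vars_def2)
  have transfer: "expectation (\<lambda>\<omega>. f (U i \<omega>)) = expectation (\<lambda>\<omega>. f (Y \<omega>))"
    if [measurable]: "f \<in> borel_measurable borel" for f :: "real \<Rightarrow> real" and i
    using integral_distr[of "U i" M borel f] integral_distr[of Y M borel f] distr[of i] by simp
  have bounded_U: "AE x in M. U i x \<in> {a..b}" for i
  proof -
    have "AE x in distr M borel Y. x \<in> {a..b}"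
      using bounded by (subst AE_distr_iff) auto
    then show ?thesis
      unfolding distr[of i, symmetric] by (subst (asm) AE_distr_iff) auto
  qed
  \<comment> \<open>Dominates both \<open>\<bar>U i \<omega>\<bar>\<close> and
    \<open>\<bar>Y \<omega> - \<mu>\<bar>\<close> almost surely; the summand 1 keeps the range from
    0 to K^2 nondegenerate.\<close>
  define K where "K = \<bar>a\<bar> + \<bar>b\<bar> + \<bar>\<mu>\<bar> + 1"
  have integ: "integrable M (\<lambda>\<omega>. (U i \<omega>)\<^sup>2)" for i
  proof (rule integrable_const_bound)
    show "AE \<omega> in M. norm ((U i \<omega>)\<^sup>2) \<le> K\<^sup>2"
      using bounded_U[of i]
      by eventually_elim (auto simp: K_def abs_le_square_iff[symmetric])
  qed simp
  \<comment> \<open>The variance is written \<open>(sqrt s)\<^sup>2\<close> to match the central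
    limit theorem, which takes the standard deviation as its parameter.\<close>
  let ?S = "\<lambda>n \<omega>. (\<Sum>i<n. U i \<omega> - \<mu>) / sqrt (real n * (sqrt s)\<^sup>2)"
  let ?Q = "\<lambda>n \<omega>. (\<Sum>i<n. (U i \<omega> - \<mu>)\<^sup>2) / real n"
  let ?r = "\<lambda>n. z\<^sup>2 * real n / ((real n - 1 + z\<^sup>2) * s)"
  have s: "s > 0" using var by (simp add: s_def)
  have mean_U: "expectation (U i) = \<mu>" for i
    using transfer[of "\<lambda>x. x" i] by (simp add: \<mu>_def)
  have clt: "weak_conv_m (\<lambda>n. distr M borel (?S n)) std_normal_distribution"
  proof (rule central_limit_theorem[OF indep mean_U _ integ _ distr])
    show "sqrt s > 0" using s by simp
    show "variance (U i) = (sqrt s)\<^sup>2" for i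
      using transfer[of "\<lambda>x. (x - \<mu>)\<^sup>2" i] s unfolding mean_U by (simp add: s_def \<mu>_def)
  qed
  have "tendsto_in_prob ?Q (expectation (\<lambda>\<omega>. (Y \<omega> - \<mu>)\<^sup>2))"
  proof (rule weak_law_iid_bounded)
    show "indep_vars (\<lambda>_. borel) (\<lambda>i \<omega>. (U i \<omega> - \<mu>)\<^sup>2) UNIV"
      by (rule indep_vars_compose2[OF indep, where Y="\<lambda>_ x. (x - \<mu>)\<^sup>2"]) simp
    show "distr M borel (\<lambda>\<omega>. (U i \<omega> - \<mu>)\<^sup>2) = distr M borel (\<lambda>\<omega>. (Y \<omega> - \<mu>)\<^sup>2)" for i
      using distr_distr[of "\<lambda>x. (x - \<mu>)\<^sup>2" borel borel "U i" M]
        distr_distr[of "\<lambda>x. (x - \<mu>)\<^sup>2" borel borel Y M] distr[of i] by (simp add: comp_def)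
    show "AE \<omega> in M. (Y \<omega> - \<mu>)\<^sup>2 \<in> {0..K\<^sup>2}"
      using bounded by eventually_elim (auto simp: K_def abs_le_square_iff[symmetric])
    show "0 < K\<^sup>2" by (simp add: K_def)
  qed simp
  then have Q: "tendsto_in_prob ?Q s" by (simp add: s_def \<mu>_def)
  have "?r \<longlonglongrightarrow> z\<^sup>2 * inverse s"
    using s z by real_asymp
  from tendsto_in_prob_mult_seq[OF _ Q this]
  have "tendsto_in_prob (\<lambda>n \<omega>. ?r n * ?Q n \<omega>) (z\<^sup>2 * inverse s * s)"
    by measurable
  moreover have "z\<^sup>2 * inverse s * s = z\<^sup>2"
    using s by simp
  ultimately have R: "tendsto_in_prob (\<lambda>n \<omega>. ?r n * ?Q n \<omega>) (z\<^sup>2)"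
    by (simp only:)
  have "(\<lambda>n. prob {\<omega> \<in> space M. (?S n \<omega>)\<^sup>2 \<le> ?r n * ?Q n \<omega>})
      \<longlonglongrightarrow> 2 * cdf std_normal_distribution (sqrt (z\<^sup>2)) - 1"
  proof (rule prob_le_tendsto_in_prob[OF _ _ _ _ R])
    \<comment> \<open>The limit formula for the squares holds for positive thresholds, which
      suffices since z^2 is positive.\<close>
    have "\<forall>\<^sub>F x in nhds (z\<^sup>2). x > 0"
      using z by (intro order_tendstoD(1)[OF filterlim_ident]) simp
    then show "\<forall>\<^sub>F x in nhds (z\<^sup>2). (\<lambda>n. prob {\<omega> \<in> space M. (?S n \<omega>)\<^sup>2 \<le> x})
        \<longlonglongrightarrow> 2 * cdf std_normal_distribution (sqrt x) - 1"
      by eventually_elim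
        (rule weak_conv_std_normal_square_le[OF prob_space_axioms _ clt], auto)
    show "isCont (\<lambda>x. 2 * cdf std_normal_distribution (sqrt x) - 1) (z\<^sup>2)"
      by (intro continuous_intros isCont_o2[OF isCont_real_sqrt isCont_cdf_std_normal])
  qed auto
  then have "(\<lambda>n. prob {\<omega> \<in> space M. (?S n \<omega>)\<^sup>2 \<le> ?r n * ?Q n \<omega>})
      \<longlonglongrightarrow> 2 * cdf std_normal_distribution z - 1"
    using z by simp
  moreover have "\<forall>\<^sub>F n in sequentially.
      prob {\<omega> \<in> space M. (?S n \<omega>)\<^sup>2 \<le> ?r n * ?Q n \<omega>} =
      prob {\<omega> \<in> space M. \<bar>m n \<omega> - expectation Y\<bar> \<le> z * sqrt (v n \<omega> / real n)}"
    using eventually_ge_at_top[of 2]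
  proof eventually_elim
    case (elim n)
    show ?case
      using studentized_deviation_iff[OF elim z s, of "\<lambda>i. U i _" \<mu>] s
      unfolding m_def v_def \<mu>_def[symmetric] by simp
  qed
  ultimately show ?thesis
    by (rule Lim_transform_eventually)
qed

section \<open>The chart inverse, its extension to the endpoints, and the transfer of
  coverage\<close>

lemma prob_chart_inv:
  assumes "prob_chart I G" "0 < u" "u < 1"
  shows "the_inv_into I G u \<in> I" "G (the_inv_into I G u) = u"
proof -
  have "inj_on G I" "u \<in> G ` I"
    using assms by (auto simp: prob_chart_def bij_betw_def)
  then show "the_inv_into I G u \<in> I" "G (the_inv_into I G u) = u"
    by (auto intro: the_inv_into_into f_the_inv_into_f)
qed

text \<open>The range of the chart is the whole open unit interval, so the values
  \<open>G x / 2\<close> and \<open>(1 + G x) / 2\<close> are attained, at points on either side of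
  \<open>x\<close>.\<close>

lemma prob_chart_no_endpoints:
  assumes chart: "prob_chart I G" and x: "x \<in> I"
  obtains y w where "y \<in> I" "w \<in> I" "y < x" "x < w"
proof -
  have G: "G x \<in> {0<..<1}"
    using chart x by (auto simp: prob_chart_def bij_betw_def)
  have mono: "strict_mono_on I G"
    using chart by (simp add: prob_chart_def)
  have less: "s < t" if "s \<in> I" "t \<in> I" "G s < G t" for s t
    using strict_mono_on_leD[OF mono, of t s] that by (cases "s < t") auto
  have "0 < G x / 2" "G x / 2 < 1" "0 < (1 + G x) / 2" "(1 + G x) / 2 < 1"
    using G by auto
  note inv = prob_chart_inv[OF chart this(1,2)] prob_chart_inv[OF chart this(3,4)]
  show ?thesis
    using that[OF inv(1,3)] less[OF inv(1) x] less[OF x inv(3)] inv(2,4) G by auto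
qed

text \<open>The endpoint values 0 and 1 cannot produce the point in question, as the infimum lies
  strictly below it and the supremum strictly above. Any other preimage is recovered by applying
  \<open>G\<close>.\<close>

lemma chart_inv_ext_mem_iff:
  assumes chart: "prob_chart I G" and p: "0 < p" "p < 1" and A: "A \<subseteq> {0..1}"
  shows "ereal (the_inv_into I G p) \<in> chart_inv_ext I G ` A \<longleftrightarrow> p \<in> A"
proof
  assume "p \<in> A"
  then show "ereal (the_inv_into I G p) \<in> chart_inv_ext I G ` A"
    using p by (auto simp: chart_inv_ext_def intro!: image_eqI[of _ _ p])
next
  let ?b = "the_inv_into I G p"
  assume "ereal ?b \<in> chart_inv_ext I G ` A"
  then obtain u where u: "u \<in> A" "chart_inv_ext I G u = ereal ?b" by auto
  obtain y w where yw: "y \<in> I" "w \<in> I" "y < ?b" "?b < w"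
    using prob_chart_no_endpoints[OF chart prob_chart_inv(1)[OF chart p]] .
  have "Inf (ereal ` I) \<le> ereal y" "ereal w \<le> Sup (ereal ` I)"
    using yw by (auto intro: INF_lower SUP_upper)
  then have "Inf (ereal ` I) \<noteq> ereal ?b" "Sup (ereal ` I) \<noteq> ereal ?b"
    using yw by auto
  then have u01: "0 < u" "u < 1" "the_inv_into I G u = ?b"
    using u A by (auto simp: chart_inv_ext_def less_le split: if_splits)
  then show "p \<in> A"
    using prob_chart_inv(2)[OF chart p] prob_chart_inv(2)[OF chart u01(1,2)] u(1) by simp
qed

text \<open>The positive variance rules out an almost surely constant coordinate: there the interval
  would almost surely collapse to the single point \<open>p\<close>, and the coverage would be 1
  instead of 1 - \<alpha>.\<close>

theorem theorem3p2:
  fixes M :: "'w measure" and P :: "real measure"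
    and I :: "real set" and G :: "real \<Rightarrow> real"
    and X :: "'w \<Rightarrow> real" and Xs :: "nat \<Rightarrow> 'w \<Rightarrow> real"
    and \<alpha> p b :: real
  assumes M: "prob_space M"
    and chart: "prob_chart I G"
    and X_rv: "X \<in> borel_measurable M" and X_law: "distr M borel X = P"
    and indep: "prob_space.indep_vars M (\<lambda>_. borel) Xs {1..}"
    and law: "\<And>i. i \<ge> 1 \<Longrightarrow> distr M borel (Xs i) = P"
    and P_I: "measure P I = 1"
    and p_def: "p = coord_mean M I G X"
    and b_def: "b = prob_barycenter M I G X"
    and C1: "\<exists>S. open S \<and> b \<in> S \<and> S \<subseteq> I \<and> G C1_differentiable_on S"
    and deriv_pos: "deriv G b > 0"
    and nondegenerate: "prob_space.variance M (coord I G X) > 0"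
    and \<alpha>: "0 < \<alpha>" "\<alpha> < 1"
  shows "((\<lambda>n. measure M {\<omega> \<in> space M. p \<in> mean_interval I G Xs \<alpha> n \<omega>})
            \<longlonglongrightarrow> 1 - \<alpha>) \<and>
         ((\<lambda>n. measure M {\<omega> \<in> space M. ereal b \<in> barycenter_interval I G Xs \<alpha> n \<omega>})
            \<longlonglongrightarrow> 1 - \<alpha>)"
proof -
  interpret prob_space M by fact
  let ?F = "cdf std_normal_distribution"
  define z where "z = quantile std_normal_distribution (1 - \<alpha> / 2)"
  have Fz: "?F z = 1 - \<alpha> / 2"
    using \<alpha> by (simp add: z_def cdf_std_normal_quantile)
  have "?F 0 = 1 / 2"
    using cdf_std_normal_minus[of 0] by simp
  \<comment> \<open>As \<alpha> < 1, the value 1 - \<alpha>/2 of the distribution function at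
    \<open>z\<close> exceeds its value 1/2 at 0.\<close>
  then have z: "z > 0"
    using Fz \<alpha> finite_borel_measure.cdf_nondecreasing[of std_normal_distribution z 0]
      real_distribution.finite_borel_measure_M[OF real_dist_normal_dist]
    by (cases "z > 0") auto
  \<comment> \<open>The extension of the chart by 0 is Borel on the whole line, so independence and
    equality of laws pass from the sample to its coordinates by composition.\<close>
  define g where "g = (\<lambda>x. if x \<in> I then G x else 0)"
  have g_coord: "coord I G Z = (\<lambda>\<omega>. g (Z \<omega>))" for Z :: "'w \<Rightarrow> real"
    by (simp add: fun_eq_iff coord_def g_def)
  have I: "I \<in> sets borel"
    using chart by (simp add: prob_chart_def real_interval_borel_measurable)
  have g[measurable]: "g \<in> borel_measurable borel"
    unfolding g_def using chart I
    by (intro borel_measurable_continuous_on_if) (auto simp: prob_chart_def)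
  have Xs: "random_variable borel (Xs i)" if "i \<ge> 1" for i
    using indep that by (simp add: indep_vars_def2)
  have g_range: "x \<in> I \<Longrightarrow> 0 < g x \<and> g x < 1" for x
    using chart by (auto simp: g_def prob_chart_def bij_betw_def)
  have "AE x in P. x \<in> I"
    using P_I I X_rv unfolding X_law[symmetric]
    by (intro prob_space.AE_in_set_eq_1[THEN iffD2] prob_space_distr) auto
  then have X_I: "AE \<omega> in M. X \<omega> \<in> I"
    unfolding X_law[symmetric] using X_rv I by (subst (asm) AE_distr_iff) auto
  have Y[measurable]: "random_variable borel (coord I G X)"
    using X_rv unfolding g_coord by simp
  have Y01: "AE \<omega> in M. coord I G X \<omega> \<in> {0..1}"
    using X_I by eventually_elim (use g_range in \<open>force simp: g_coord\<close>)
  have int: "integrable M (coord I G X)"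
    by (rule integrable_const_bound[of _ 1]) (use Y01 in \<open>auto elim: eventually_mono\<close>)
  have p: "p = expectation (coord I G X)"
    by (simp add: p_def coord_mean_def)
  \<comment> \<open>Strict bounds almost surely give strict bounds for the mean, so \<open>p\<close>
    is a value of the chart.\<close>
  have "AE \<omega> in M. 0 < coord I G X \<omega>" "AE \<omega> in M. coord I G X \<omega> < 1"
    using X_I by (eventually_elim, simp add: g_coord g_range)+
  then have p01: "0 < p" "p < 1"
    unfolding p by (simp_all add: expectation_greater[OF int] expectation_less[OF int])
  \<comment> \<open>The sample starts at index 1, the sequence of
    \<open>studentized_mean_coverage\<close> at 0.\<close>
  let ?U = "\<lambda>i. coord I G (Xs (Suc i))"
  have "indep_vars (\<lambda>_. borel) (\<lambda>i. Xs (Suc i)) UNIV"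
    by (rule indep_vars_reindex) (auto intro: indep_vars_subset[OF indep])
  then have indep_U: "indep_vars (\<lambda>_. borel) ?U UNIV"
    unfolding g_coord by (rule indep_vars_compose2) simp
  have distr_U: "distr M borel (?U i) = distr M borel (coord I G X)" for i
    using distr_distr[OF g Xs[of "Suc i"]] distr_distr[OF g X_rv] law[of "Suc i"] X_law
    by (simp add: g_coord comp_def)
  have mean: "coord_sample_mean I G Xs n \<omega> = (\<Sum>i<n. ?U i \<omega>) / real n" for n \<omega>
    by (simp add: coord_sample_mean_def sum.atLeast1_atMost_eq)
  have var: "coord_sample_var I G Xs n \<omega> =
      (\<Sum>i<n. (?U i \<omega> - (\<Sum>i<n. ?U i \<omega>) / real n)\<^sup>2) / (real n - 1)" for n \<omega>
    by (simp add: coord_sample_var_def mean sum.atLeast1_atMost_eq)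
  \<comment> \<open>Since \<open>p\<close> lies in the unit interval, the truncation to it does not
    affect whether \<open>p\<close> is covered.\<close>
  have "p \<in> mean_interval I G Xs \<alpha> n \<omega> \<longleftrightarrow>
      \<bar>coord_sample_mean I G Xs n \<omega> - p\<bar> \<le> z * sqrt (coord_sample_var I G Xs n \<omega> / real n)" for n \<omega>
    using p01 by (auto simp: mean_interval_def Let_def z_def[symmetric])
  then have lim: "(\<lambda>n. prob {\<omega> \<in> space M. p \<in> mean_interval I G Xs \<alpha> n \<omega>}) \<longlonglongrightarrow> 1 - \<alpha>"
    using studentized_mean_coverage[OF indep_U distr_U Y Y01 nondegenerate z]
    by (simp add: mean var p Fz)
  have "ereal b \<in> barycenter_interval I G Xs \<alpha> n \<omega> \<longleftrightarrow> p \<in> mean_interval I G Xs \<alpha> n \<omega>" for n \<omega>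
    unfolding b_def prob_barycenter_def p_def[symmetric] barycenter_interval_def
    by (intro chart_inv_ext_mem_iff[OF chart p01]) (auto simp: mean_interval_def Let_def)
  with lim show ?thesis by simp
qed

end
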